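(* Let $t_0<t_f$. Let $n_r$ receiver positions $\mathbf{b}_1,\dots,\mathbf{b}_{n_r}\in\mathbb{R}^3$ be given, at least four of which are non-coplanar, and consider the nonlinear system $$\dot{\mathbf{x}}_1(t)=-\mathbf{x}_2(t)-\mathbf{u}(t),\quad \dot{\mathbf{x}}_2(t)=\mathbf{0},\quad \rho_i(t)=\|\mathbf{b}_i-\mathcal{R}^T(t)\mathbf{x}_1(t)\|,\ i=1,\dots,n_r, \qquad(\mathrm{NL})$$ along trajectories for which there are constants $R_{min},R_{max}>0$ with $R_{min}\le\rho_i(t)\le R_{max}$ for all $t\ge t_0$ and all $i$. Then: (1) (NL) is observable in the sense that, given $\{\mathbf{y}(t),t\in[t_0,t_f]\}$ and $\{\mathbf{u}(t),t\in[t_0,t_f]\}$, the initial state $\begin{bmatrix}\mathbf{x}_1^T(t_0)&\mathbf{x}_2^T(t_0)\end{bmatrix}^T$ is uniquely defined. (2) A state observer for the linear time-varying system $$\dot{\mathbf{x}}(t)=\mathbf{A}(t)\mathbf{x}(t)+\mathbf{B}(t)\mathbf{u}(t),\quad \mathbf{y}(t)=\mathbf{C}(t)\mathbf{x}(t) \qquad(\mathrm{LTV})$$ (defined in the context) with globally asymptotically stable error dynamics is also a state observer for the nonlinear system (NL), with globally asymptotically stable error dynamics.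
   Context: **Signals.** $\mathcal{R}(t)\in SO(3)$ is a known rotation matrix satisfying $\dot{\mathcal{R}}(t)=\mathcal{R}(t)\mathcal{S}(\omega(t))$, where $\omega(t)\in\mathbb{R}^3$ is known and continuous and $\mathcal{S}(\omega)$ is the skew-symmetric matrix with $\mathcal{S}(\omega)a=\omega\times a$. The input $\mathbf{u}(t)\in\mathbb{R}^3$ is a known continuous bounded signal. The ranges $\rho_i(t)$ are the measured outputs along the trajectory of (NL) under consideration. **The system (LTV).** Given the signals $\mathcal{R},\omega,\mathbf{u}$ and the measured $\rho_1,\dots,\rho_{n_r}$, treated as known functions of time, (LTV) has state $\mathbf{x}(t)\in\mathbb{R}^{8+n_r}$, split into blocks of sizes $3,3,n_r,1,1$, and $$\mathbf{A}(t)=\begin{bmatrix}\mathbf{0}&-\mathbf{I}&\mathbf{0}&\mathbf{0}&\mathbf{0}\\ \mathbf{0}&\mathbf{0}&\mathbf{0}&\mathbf{0}&\mathbf{0}\\ \frac{\mathbf{b}_1^T\mathcal{S}(\omega(t))\mathcal{R}^T(t)-\mathbf{u}^T(t)}{\rho_1(t)}&\frac{\mathbf{b}_1^T\mathcal{R}^T(t)}{\rho_1(t)}&\mathbf{0}&-\frac1{\rho_1(t)}&0\\ \vdots&\vdots&\vdots&\vdots&\vdots\\ \frac{\mathbf{b}_{n_r}^T\mathcal{S}(\omega(t))\mathcal{R}^T(t)-\mathbf{u}^T(t)}{\rho_{n_r}(t)}&\frac{\mathbf{b}_{n_r}^T\mathcal{R}^T(t)}{\rho_{n_r}(t)}&\mathbf{0}&-\frac1{\rho_{n_r}(t)}&0\\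 \mathbf{0}&-\mathbf{u}^T(t)&\mathbf{0}&0&-1\\ \mathbf{0}&\mathbf{0}&\mathbf{0}&0&0\end{bmatrix},$$ $$\mathbf{B}(t)=\begin{bmatrix}-\mathbf{I}_3&\mathbf{0}&\frac{\mathcal{R}(t)\mathbf{b}_1}{\rho_1(t)}&\cdots&\frac{\mathcal{R}(t)\mathbf{b}_{n_r}}{\rho_{n_r}(t)}&\mathbf{0}&\mathbf{0}\end{bmatrix}^T,\qquad \mathbf{C}(t)=\begin{bmatrix}\mathbf{0}_{n_r\times3}&\mathbf{0}_{n_r\times3}&\mathbf{C}_0&\mathbf{0}_{n_r\times2}\\ \mathbf{C}_1(t)&\mathbf{0}_{n_C\times3}&\mathbf{C}_2&\mathbf{0}_{n_C\times2}\end{bmatrix},$$ where $n_C=n_r(n_r-1)/2$. Let $e_1,\dots,e_{n_r}$ be the standard basis of $\mathbb{R}^{n_r}$. $\mathbf{C}_0\in\mathbb{R}^{n_r\times n_r}$ has first row $e_1^T$ and $k$-th row $(e_1-e_k)^T$ for $k=2,\dots,n_r$. The rows of $\mathbf{C}_1(t)\in\mathbb{R}^{n_C\times3}$ and $\mathbf{C}_2\in\mathbb{R}^{n_C\times n_r}$ are indexed by the pairs $(i,j)$, $1\le i<j\le n_r$, in lexicographic order; the $(i,j)$ rows are respectively $\frac{2(\mathbf{b}_i-\mathbf{b}_j)^T\mathcal{R}^T(t)}{\rho_i(t)+\rho_j(t)}$ and $(e_i-e_j)^T$. **Augmented state and measured output of (NL).** Along a trajectory of (NL), the augmented state is $$\mathbf{x}^{aug}(t)=\begin{bmatrix}\mathbf{x}_1^T(t)&\mathbf{x}_2^T(t)&\rho_1(t)&\cdots&\rho_{n_r}(t)&\mathbf{x}_1^T(t)\mathbf{x}_2(t)&\|\mathbf{x}_2(t)\|^2\end{bmatrix}^T.$$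 The measured signal $\mathbf{y}(t)\in\mathbb{R}^{n_r+n_C}$ along a trajectory of (NL) has components $\rho_1$; $\rho_1-\rho_j$ for $j=2,\dots,n_r$; and $\frac{\|\mathbf{b}_i\|^2-\|\mathbf{b}_j\|^2}{\rho_i+\rho_j}$ for $1\le i<j\le n_r$ in lexicographic order (it is thus computable from the ranges). **Observers.** A state observer for (LTV) with globally asymptotically stable error dynamics is a dynamical system $\dot{\hat{\mathbf{x}}}(t)=F(t,\hat{\mathbf{x}}(t),\mathbf{y}(t))$ on $\mathbb{R}^{8+n_r}$, where $F$ may depend on the known signals, such that for every solution $\mathbf{x}(t)$ of (LTV), with $\mathbf{y}=\mathbf{C}\mathbf{x}$, the error $\hat{\mathbf{x}}(t)-\mathbf{x}(t)$ has the origin as a globally asymptotically stable equilibrium (Lyapunov stable, and converging to zero for every initial estimate $\hat{\mathbf{x}}(t_0)$). It is a state observer for (NL) with globally asymptotically stable error dynamics if, when it is driven by the measured signal $\mathbf{y}$ of the trajectory of (NL) that generates the ranges $\rho_i$, the error $\hat{\mathbf{x}}(t)-\mathbf{x}^{aug}(t)$ has the origin as a globally asymptotically stable equilibrium; the first two $\mathbb{R}^3$-blocks of $\hat{\mathbf{x}}(t)$ are the estimates of $\mathbf{x}_1(t),\mathbf{x}_2(t)$. *)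

theory Defs
  imports "HOL-Analysis.Analysis"
begin

text \<open>
  The receivers are indexed by an arbitrary finite linearly ordered type \<open>'n\<close>, so that
  \<open>CARD('n)\<close> is the number of receivers and \<open>Min UNIV\<close> is the first one.  All signals and all
  trajectories live on the time interval \<open>{t0..}\<close>; derivatives are taken within it
  (one-sided at \<open>t0\<close>).
\<close>

text \<open>
  Pairs \<open>i < j\<close> of receivers; being an index type, it needs no listing order.  The second disjunct is only there because a type cannot be
  empty: it matters only for a single receiver, see \<open>card_index_pair\<close>.
\<close>

typedef (overloaded) ('n::linorder) index_pair =
  "{(i :: 'n, j :: 'n). i < j \<or> (\<forall>k l :: 'n. k = l)}"
  by auto (meson linorder_neqE)

definition pfst :: "'n::linorder index_pair \<Rightarrow> 'n" where
  "pfst p = fst (Rep_index_pair p)"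

definition psnd :: "'n::linorder index_pair \<Rightarrow> 'n" where
  "psnd p = snd (Rep_index_pair p)"

instance index_pair :: ("{finite, linorder}") finite
proof
  show "finite (UNIV :: 'a index_pair set)"
    by (rule finite_imageD[where f = Rep_index_pair])
       (auto intro: finite_subset[OF subset_UNIV] simp: inj_on_def Rep_index_pair_inject)
qed

lemma pfst_less_psnd:
  fixes p :: "'n::{finite, linorder} index_pair"
  assumes "CARD('n) \<ge> 2"
  shows "pfst p < psnd p"
proof -
  have "\<not> (\<forall>k l :: 'n. k = l)"
  proof
    assume "\<forall>k l :: 'n. k = l"
    then have "(UNIV :: 'n set) = {undefined}" by auto
    then have "CARD('n) = card {undefined :: 'n}" by simp
    with assms show False by simp
  qed
  with Rep_index_pair[of p] show ?thesis
    by (auto simp: pfst_def psnd_def)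
qed

lemma card_index_pair:
  assumes "CARD('n::{finite, linorder}) \<ge> 2"
  shows "CARD('n index_pair) = CARD('n) * (CARD('n) - 1) div 2"
proof -
  let ?L = "{(i :: 'n, j :: 'n). i < j}"
  let ?G = "{(i :: 'n, j :: 'n). j < i}"
  have ne: "\<not> (\<forall>k l :: 'n. k = l)"
  proof
    assume "\<forall>k l :: 'n. k = l"
    then have "(UNIV :: 'n set) = {undefined}" by auto
    then have "CARD('n) = card {undefined :: 'n}" by simp
    with assms show False by simp
  qed
  have "CARD('n index_pair) = card {(i :: 'n, j :: 'n). i < j \<or> (\<forall>k l :: 'n. k = l)}"
    by (rule type_definition.card[OF type_definition_index_pair])
  then have "CARD('n index_pair) = card ?L"
    by (simp only: ne simp_thms)
  moreover have "card ?G = card ?L"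
    by (rule bij_betw_same_card[of prod.swap]) (auto simp: bij_betw_def inj_on_def image_iff)
  moreover have "card (UNIV :: ('n \<times> 'n) set) = card (?L \<union> ?G \<union> Id)"
    by (rule arg_cong[where f = card]) auto
  moreover have "card (?L \<union> ?G \<union> Id) = card ?L + card ?G + card (Id :: ('n \<times> 'n) set)"
    by (subst card_Un_disjoint, auto)+
  moreover have "card (Id :: ('n \<times> 'n) set) = CARD('n)"
    by (rule bij_betw_same_card[of fst]) (force simp: bij_betw_def inj_on_def image_iff)
  moreover have "card (UNIV :: ('n \<times> 'n) set) = CARD('n) * CARD('n)"
    by simp
  ultimately show ?thesis
    by (simp add: diff_mult_distrib2)
qed

text \<open>Here \<open>+\<close> is the disjoint sum of index types, so \<open>'n state\<close> has dimension \<open>8 + CARD('n)\<close>.\<close>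

type_synonym 'n state = "real ^ (3 + 3 + 'n + 1 + 1)"
type_synonym 'n meas = "real ^ ('n + 'n index_pair)"

definition blocks ::
  "real^3 \<Rightarrow> real^3 \<Rightarrow> real^'n \<Rightarrow> real \<Rightarrow> real \<Rightarrow> 'n::finite state" where
  "blocks p q r c d = (\<chi> s. case s of
       Inl k \<Rightarrow> p $ k
     | Inr (Inl k) \<Rightarrow> q $ k
     | Inr (Inr (Inl i)) \<Rightarrow> r $ i
     | Inr (Inr (Inr (Inl _))) \<Rightarrow> c
     | Inr (Inr (Inr (Inr _))) \<Rightarrow> d)"

definition skew :: "real^3 \<Rightarrow> real^3^3" where
  "skew w = matrix (cross3 w)"

definition first_receiver :: "'n::{finite, linorder}" where
  "first_receiver = Min UNIV"

definition attitude_signal ::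
  "real \<Rightarrow> (real \<Rightarrow> real^3^3) \<Rightarrow> (real \<Rightarrow> real^3) \<Rightarrow> bool" where
  "attitude_signal t0 R w \<longleftrightarrow>
     continuous_on {t0..} w \<and>
     (\<forall>t\<ge>t0. rotation_matrix (R t) \<and>
        (R has_vector_derivative R t ** skew (w t)) (at t within {t0..}))"

definition input_signal :: "real \<Rightarrow> (real \<Rightarrow> real^3) \<Rightarrow> bool" where
  "input_signal t0 u \<longleftrightarrow> continuous_on {t0..} u \<and> bounded (u ` {t0..})"

subsection \<open>The nonlinear system\<close>

definition nl_range ::
  "('n \<Rightarrow> real^3) \<Rightarrow> (real \<Rightarrow> real^3^3) \<Rightarrow> (real \<Rightarrow> real^3) \<Rightarrow> 'n \<Rightarrow> real \<Rightarrow> real" where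
  "nl_range b R x1 i t = norm (b i - transpose (R t) *v x1 t)"

definition nl_trajectory ::
  "('n \<Rightarrow> real^3) \<Rightarrow> (real \<Rightarrow> real^3^3) \<Rightarrow> (real \<Rightarrow> real^3) \<Rightarrow> real
    \<Rightarrow> (real \<Rightarrow> real^3) \<Rightarrow> (real \<Rightarrow> real^3) \<Rightarrow> bool" where
  "nl_trajectory b R u t0 x1 x2 \<longleftrightarrow>
     (\<forall>t\<ge>t0. (x1 has_vector_derivative - x2 t - u t) (at t within {t0..}) \<and>
             (x2 has_vector_derivative 0) (at t within {t0..})) \<and>
     (\<exists>Rmin Rmax. Rmin > 0 \<and> Rmax > 0 \<and>
        (\<forall>t\<ge>t0. \<forall>i. Rmin \<le> nl_range b R x1 i t \<and> nl_range b R x1 i t \<le> Rmax))"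

definition nl_output ::
  "('n \<Rightarrow> real^3) \<Rightarrow> ('n \<Rightarrow> real \<Rightarrow> real) \<Rightarrow> real \<Rightarrow> 'n::{finite, linorder} meas" where
  "nl_output b \<rho> t = (\<chi> m. case m of
       Inl k \<Rightarrow> if k = first_receiver then \<rho> first_receiver t else \<rho> first_receiver t - \<rho> k t
     | Inr p \<Rightarrow> ((norm (b (pfst p)))\<^sup>2 - (norm (b (psnd p)))\<^sup>2) / (\<rho> (pfst p) t + \<rho> (psnd p) t))"

definition augmented_state ::
  "('n \<Rightarrow> real \<Rightarrow> real) \<Rightarrow> (real \<Rightarrow> real^3) \<Rightarrow> (real \<Rightarrow> real^3) \<Rightarrow> real \<Rightarrow> 'n::finite state" where
  "augmented_state \<rho> x1 x2 t =
     blocks (x1 t) (x2 t) (\<chi> i. \<rho> i t) (x1 t \<bullet> x2 t) ((norm (x2 t))\<^sup>2)"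

text \<open>
  The rotation is a known signal and hence common to both trajectories; of the inputs only the
  restriction to \<open>{t0..tf}\<close> is given, so the two inputs may differ after \<open>tf\<close>.
\<close>

definition nl_observable ::
  "('n::{finite, linorder} \<Rightarrow> real^3) \<Rightarrow> (real \<Rightarrow> real^3^3) \<Rightarrow> real \<Rightarrow> real \<Rightarrow> bool" where
  "nl_observable b R t0 tf \<longleftrightarrow>
     (\<forall>u u' x1 x2 x1' x2'.
        input_signal t0 u \<and> input_signal t0 u' \<and>
        nl_trajectory b R u t0 x1 x2 \<and> nl_trajectory b R u' t0 x1' x2' \<and>
        (\<forall>t\<in>{t0..tf}. u t = u' t) \<and>
        (\<forall>t\<in>{t0..tf}. nl_output b (nl_range b R x1) t = nl_output b (nl_range b R x1') t)
        \<longrightarrow> x1 t0 = x1' t0 \<and> x2 t0 = x2' t0)"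

subsection \<open>The linear time-varying system\<close>

definition ltv_A ::
  "('n \<Rightarrow> real^3) \<Rightarrow> (real \<Rightarrow> real^3^3) \<Rightarrow> (real \<Rightarrow> real^3) \<Rightarrow> (real \<Rightarrow> real^3)
    \<Rightarrow> ('n \<Rightarrow> real \<Rightarrow> real) \<Rightarrow> real \<Rightarrow> real ^ (3 + 3 + 'n + 1 + 1) ^ (3 + 3 + 'n::finite + 1 + 1)" where
  "ltv_A b R w u \<rho> t = (\<chi> s. case s of
       Inl k \<Rightarrow> blocks 0 (- axis k 1) 0 0 0
     | Inr (Inl k) \<Rightarrow> 0
     | Inr (Inr (Inl i)) \<Rightarrow>
         blocks ((1 / \<rho> i t) *\<^sub>R (b i v* (skew (w t) ** transpose (R t)) - u t))
                ((1 / \<rho> i t) *\<^sub>R (b i v* transpose (R t))) 0 (- 1 / \<rho> i t) 0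
     | Inr (Inr (Inr (Inl _))) \<Rightarrow> blocks 0 (- u t) 0 0 (- 1)
     | Inr (Inr (Inr (Inr _))) \<Rightarrow> 0)"

text \<open>Listed by rows, i.e. by the columns of its transpose.\<close>

definition ltv_B ::
  "('n \<Rightarrow> real^3) \<Rightarrow> (real \<Rightarrow> real^3^3) \<Rightarrow> ('n \<Rightarrow> real \<Rightarrow> real) \<Rightarrow> real
    \<Rightarrow> real ^ 3 ^ (3 + 3 + 'n::finite + 1 + 1)" where
  "ltv_B b R \<rho> t = (\<chi> s. case s of
       Inl k \<Rightarrow> - axis k 1
     | Inr (Inl k) \<Rightarrow> 0
     | Inr (Inr (Inl i)) \<Rightarrow> (1 / \<rho> i t) *\<^sub>R (R t *v b i)
     | Inr (Inr (Inr (Inl _))) \<Rightarrow> 0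
     | Inr (Inr (Inr (Inr _))) \<Rightarrow> 0)"

definition ltv_C ::
  "('n \<Rightarrow> real^3) \<Rightarrow> (real \<Rightarrow> real^3^3) \<Rightarrow> ('n \<Rightarrow> real \<Rightarrow> real) \<Rightarrow> real
    \<Rightarrow> real ^ (3 + 3 + 'n + 1 + 1) ^ ('n + 'n::{finite, linorder} index_pair)" where
  "ltv_C b R \<rho> t = (\<chi> m. case m of
       Inl k \<Rightarrow> blocks 0 0
         (if k = first_receiver then axis first_receiver 1
          else axis first_receiver 1 - axis k 1) 0 0
     | Inr p \<Rightarrow> blocks
         ((2 / (\<rho> (pfst p) t + \<rho> (psnd p) t)) *\<^sub>R ((b (pfst p) - b (psnd p)) v* transpose (R t)))
         0 (axis (pfst p) 1 - axis (psnd p) 1) 0 0)"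

definition ltv_solution ::
  "('n::finite \<Rightarrow> real^3) \<Rightarrow> (real \<Rightarrow> real^3^3) \<Rightarrow> (real \<Rightarrow> real^3) \<Rightarrow> (real \<Rightarrow> real^3)
    \<Rightarrow> ('n \<Rightarrow> real \<Rightarrow> real) \<Rightarrow> real \<Rightarrow> (real \<Rightarrow> 'n state) \<Rightarrow> bool" where
  "ltv_solution b R w u \<rho> t0 x \<longleftrightarrow>
     (\<forall>t\<ge>t0. (x has_vector_derivative ltv_A b R w u \<rho> t *v x t + ltv_B b R \<rho> t *v u t)
               (at t within {t0..}))"

subsection \<open>Observers\<close>

definition observer_solution ::
  "(real \<Rightarrow> 'x::real_normed_vector \<Rightarrow> 'y \<Rightarrow> 'x) \<Rightarrow> (real \<Rightarrow> 'y) \<Rightarrow> real \<Rightarrow> (real \<Rightarrow> 'x) \<Rightarrow> bool" where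
  "observer_solution F y t0 xh \<longleftrightarrow>
     (\<forall>t\<ge>t0. (xh has_vector_derivative F t (xh t) (y t)) (at t within {t0..}))"

text \<open>
  The conjuncts: every initial estimate gives rise to an estimate trajectory on \<open>{t0..}\<close>
  (otherwise the remaining ones could hold vacuously); the zero error is an equilibrium; it is
  Lyapunov stable; it is globally attractive.
\<close>

definition gas_error ::
  "(real \<Rightarrow> 'x::real_normed_vector \<Rightarrow> 'y \<Rightarrow> 'x) \<Rightarrow> (real \<Rightarrow> 'y) \<Rightarrow> real \<Rightarrow> (real \<Rightarrow> 'x) \<Rightarrow> bool" where
  "gas_error F y t0 x \<longleftrightarrow>
     (\<forall>z. \<exists>xh. observer_solution F y t0 xh \<and> xh t0 = z) \<and>
     observer_solution F y t0 x \<and>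
     (\<forall>\<epsilon>>0. \<exists>\<delta>>0. \<forall>xh. observer_solution F y t0 xh \<and> norm (xh t0 - x t0) < \<delta> \<longrightarrow>
        (\<forall>t\<ge>t0. norm (xh t - x t) < \<epsilon>)) \<and>
     (\<forall>xh. observer_solution F y t0 xh \<longrightarrow> ((\<lambda>t. xh t - x t) \<longlongrightarrow> 0) at_top)"

text \<open>
  Both notions refer to a fixed choice of the known signals, including the ranges, so \<open>F\<close> may
  depend on them.
\<close>

definition ltv_observer ::
  "('n::{finite, linorder} \<Rightarrow> real^3) \<Rightarrow> (real \<Rightarrow> real^3^3) \<Rightarrow> (real \<Rightarrow> real^3) \<Rightarrow> (real \<Rightarrow> real^3)
    \<Rightarrow> ('n \<Rightarrow> real \<Rightarrow> real) \<Rightarrow> real \<Rightarrow> (real \<Rightarrow> 'n state \<Rightarrow> 'n meas \<Rightarrow> 'n state) \<Rightarrow> bool" where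
  "ltv_observer b R w u \<rho> t0 F \<longleftrightarrow>
     (\<forall>x. ltv_solution b R w u \<rho> t0 x \<longrightarrow> gas_error F (\<lambda>t. ltv_C b R \<rho> t *v x t) t0 x)"

definition nl_observer ::
  "('n::{finite, linorder} \<Rightarrow> real^3) \<Rightarrow> (real \<Rightarrow> real^3^3) \<Rightarrow> real
    \<Rightarrow> (real \<Rightarrow> real^3) \<Rightarrow> (real \<Rightarrow> real^3)
    \<Rightarrow> (real \<Rightarrow> 'n state \<Rightarrow> 'n meas \<Rightarrow> 'n state) \<Rightarrow> bool" where
  "nl_observer b R t0 x1 x2 F \<longleftrightarrow>
     gas_error F (nl_output b (nl_range b R x1)) t0 (augmented_state (nl_range b R x1) x1 x2)"

end

theory Submission
  imports Defs
begin

text \<open>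
  The ranges can be read off the output.  Since
  \<open>\<rho>\<^sub>i\<^sup>2 = \<parallel>b\<^sub>i\<parallel>\<^sup>2 - 2 b\<^sub>i \<bullet> R\<^sup>T x\<^sub>1 + \<parallel>x\<^sub>1\<parallel>\<^sup>2\<close>, two trajectories with the same ranges have positions whose
  difference, rotated by \<open>R\<^sup>T\<close>, has the same inner product with all \<open>b\<^sub>i\<close>; were it nonzero, all
  \<open>b\<^sub>i\<close> would lie in one plane.  So the positions agree on the whole interval, and differentiating at
  \<open>t\<^sub>0\<close> gives the velocities.  For the observer, the augmented state is a solution of the linear
  system, and by the same formula for \<open>\<rho>\<^sub>i\<^sup>2 - \<rho>\<^sub>j\<^sup>2\<close> its linear output is the measured one.
\<close>

section \<open>Planes and coplanar points\<close>

lemma coplanar_subset_hyperplane: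
  fixes a :: "real^3"
  assumes "a \<noteq> 0" "S \<subseteq> {x. a \<bullet> x = c}"
  shows "coplanar S"
proof -
  \<comment> \<open>Coplanarity depends only on the affine hull, so \<open>S\<close> may be replaced
    by an affine basis \<open>B\<close>. Inside a plane of dimension 2 it has at most three points,
    and these are always coplanar.\<close>
  obtain B where B: "B \<subseteq> S" "\<not> affine_dependent B" "affine hull S = affine hull B"
    using affine_basis_exists by blast
  have "int (card B) = aff_dim B + 1"
    using aff_dim_affine_independent[OF B(2)] by simp
  also have "aff_dim B \<le> aff_dim {x. a \<bullet> x = c}"
    using B(1) assms(2) by (intro aff_dim_subset) auto
  also have "\<dots> = 2"
    using assms(1) by simp
  finally have "card B \<le> 3" by simp
  then have "coplanar B"
    using B(2) aff_independent_finite by (intro coplanar_small) auto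
  then show ?thesis
    using B(3) coplanar_affine_hull_coplanar by metis
qed

section \<open>Block vectors and derivatives of vector signals\<close>

lemma sum_UNIV_sum:
  fixes f :: "'a::finite + 'b::finite \<Rightarrow> 'c::comm_monoid_add"
  shows "sum f UNIV = (\<Sum>i\<in>UNIV. f (Inl i)) + (\<Sum>i\<in>UNIV. f (Inr i))"
  by (subst UNIV_Plus_UNIV[symmetric], subst sum.Plus) (simp_all add: o_def)

text \<open>The nonzero rows of \<open>ltv_A\<close> and all rows of \<open>ltv_C\<close> are block
  vectors, so this turns their products with a state into blockwise formulas.\<close>

lemma inner_blocks:
  "blocks p q r c d \<bullet> blocks p' q' r' c' d' = p \<bullet> p' + q \<bullet> q' + r \<bullet> r' + c * c' + d * d'"
  by (simp add: inner_vec_def blocks_def sum_UNIV_sum)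

lemma blocks_component [simp]:
  "blocks p q r c d $ Inl k = p $ k"
  "blocks p q r c d $ Inr (Inl k) = q $ k"
  "blocks p q r c d $ Inr (Inr (Inl i)) = r $ i"
  "blocks p q r c d $ Inr (Inr (Inr (Inl e))) = c"
  "blocks p q r c d $ Inr (Inr (Inr (Inr e))) = d"
  by (simp_all add: blocks_def)

lemma blocks_eqI:
  assumes "\<And>k. x $ Inl k = p $ k" "\<And>k. x $ Inr (Inl k) = q $ k"
    "\<And>i. x $ Inr (Inr (Inl i)) = r $ i"
    "\<And>e. x $ Inr (Inr (Inr (Inl e))) = c" "\<And>e. x $ Inr (Inr (Inr (Inr e))) = d"
  shows "x = blocks p q r c d"
  unfolding vec_eq_iff blocks_def using assms by (auto split: sum.split)

lemma blocks_add:
  "blocks p q r c d + blocks p' q' r' c' d' = blocks (p + p') (q + q') (r + r') (c + c') (d + d')"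
  by (rule blocks_eqI) simp_all

lemma has_vector_derivative_vecI:
  fixes f :: "real \<Rightarrow> real^'n"
  assumes "\<And>i. ((\<lambda>t. f t $ i) has_vector_derivative f' $ i) (at t within S)"
  shows "(f has_vector_derivative f') (at t within S)"
  unfolding has_vector_derivative_def
  by (subst has_derivative_componentwise_within)
     (use assms in \<open>auto simp: Basis_vec_def inner_axis has_vector_derivative_def\<close>)

lemma has_vector_derivative_vec_nth:
  fixes f :: "real \<Rightarrow> real^'n"
  assumes "(f has_vector_derivative f') (at t within S)"
  shows "((\<lambda>t. f t $ i) has_vector_derivative f' $ i) (at t within S)"
  using bounded_linear.has_vector_derivative[OF bounded_linear_vec_nth assms] .

lemma has_vector_derivative_blocks:
  assumes "(p has_vector_derivative p') (at t within S)"
    "(q has_vector_derivative q') (at t within S)"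
    "\<And>i. ((\<lambda>t. r t $ i) has_vector_derivative r' $ i) (at t within S)"
    "(c has_vector_derivative c') (at t within S)"
    "(d has_vector_derivative d') (at t within S)"
  shows "((\<lambda>t. blocks (p t) (q t) (r t) (c t) (d t)) has_vector_derivative blocks p' q' r' c' d')
    (at t within S)"
proof (rule has_vector_derivative_vecI)
  fix s :: "3 + 3 + 'a + 1 + 1"
  show "((\<lambda>t. blocks (p t) (q t) (r t) (c t) (d t) $ s) has_vector_derivative
      blocks p' q' r' c' d' $ s) (at t within S)"
    unfolding blocks_def using assms
    by (auto intro: has_vector_derivative_vec_nth split: sum.split)
qed

text \<open>Supplies the product rule for \<open>x1 t v* R t\<close>, in which both factors vary
  with time.\<close>

lemma bounded_bilinear_vector_matrix_mult:
  "bounded_bilinear (\<lambda>(x :: real^'m) (A :: real^'n^'m). x v* A)"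
  unfolding bilinear_conv_bounded_bilinear[symmetric]
  by (auto simp: bilinear_def vector_matrix_mult_add_rdistrib vector_matrix_left_distrib
        scaleR_vector_matrix_assoc vector_scaleR_matrix_ac intro!: linearI)

section \<open>Products with the system matrices\<close>

lemma skew_mult: "skew w *v a = cross3 w a"
proof -
  have "linear (cross3 w)"
    using bilinear_cross by (auto simp: bilinear_def)
  then show ?thesis
    by (simp add: skew_def matrix_works)
qed

lemma ltv_A_mult_blocks:
  "ltv_A b R w u \<rho> t *v blocks p q r c d =
     blocks (- q) 0
       (\<chi> i. (b i \<bullet> cross3 (w t) (p v* R t) - u t \<bullet> p + b i \<bullet> (q v* R t) - c) / \<rho> i t)
       (- (u t \<bullet> q) - d) 0"
proof (rule blocks_eqI)
  fix i
  show "(ltv_A b R w u \<rho> t *v blocks p q r c d) $ Inr (Inr (Inl i)) =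
    (\<chi> i. (b i \<bullet> cross3 (w t) (p v* R t) - u t \<bullet> p + b i \<bullet> (q v* R t) - c) / \<rho> i t) $ i"
    \<comment> \<open>With \<open>vector_transpose_matrix\<close> active,
      \<open>b i v* transpose (R t)\<close> would become \<open>R t *v b i\<close>, and
      \<open>dot_lmul_matrix\<close> could not carry the rotation over to the state blocks.\<close>
    by (simp add: matrix_vector_mul_component ltv_A_def inner_blocks dot_lmul_matrix
        inner_diff_left skew_mult add_divide_distrib diff_divide_distrib
        matrix_vector_mul_assoc[symmetric] del: vector_transpose_matrix)
qed (simp_all add: matrix_vector_mul_component ltv_A_def inner_blocks inner_axis'
       inner_minus_left)

lemma ltv_B_mult:
  "ltv_B b R \<rho> t *v v = blocks (- v) 0 (\<chi> i. b i \<bullet> (v v* R t) / \<rho> i t) 0 0"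
  by (rule blocks_eqI)
    (simp_all add: matrix_vector_mul_component ltv_B_def inner_axis' inner_commute[of "b _"]
       dot_lmul_matrix inner_commute[of v] inner_axis)

section \<open>Ranges, measured output and augmented dynamics\<close>

lemma rotation_matrix_inner:
  fixes Q :: "real^'n^'n"
  assumes "rotation_matrix Q"
  shows "(x v* Q) \<bullet> (y v* Q) = x \<bullet> y"
proof -
  have "(x v* Q) \<bullet> (y v* Q) = x \<bullet> ((Q ** transpose Q) *v y)"
    by (simp add: dot_lmul_matrix matrix_vector_mul_assoc[symmetric])
  also have "Q ** transpose Q = mat 1"
    using assms by (simp add: rotation_matrix_def orthogonal_matrix_def)
  finally show ?thesis by simp
qed

text \<open>The rotation preserves \<open>norm (x1 t)\<close>, so the quadratic term does not depend
  on \<open>i\<close>.\<close>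

lemma nl_range_power2:
  assumes "rotation_matrix (R t)"
  shows "(nl_range b R x1 i t)\<^sup>2 = (norm (b i))\<^sup>2 - 2 * (b i \<bullet> (x1 t v* R t)) + (norm (x1 t))\<^sup>2"
  using rotation_matrix_inner[OF assms, of "x1 t" "x1 t"]
  by (simp add: nl_range_def power2_norm_eq_inner inner_diff_left inner_diff_right inner_commute)

lemma ltv_C_mult_augmented_state:
  assumes "rotation_matrix (R t)" and pos: "\<And>i. nl_range b R x1 i t > 0"
  shows "ltv_C b R (nl_range b R x1) t *v augmented_state (nl_range b R x1) x1 x2 t =
    nl_output b (nl_range b R x1) t"
proof -
  let ?\<rho> = "nl_range b R x1"
  have pair: "2 / (?\<rho> i t + ?\<rho> j t) * ((b i - b j) \<bullet> (x1 t v* R t)) + (?\<rho> i t - ?\<rho> j t) =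
    ((norm (b i))\<^sup>2 - (norm (b j))\<^sup>2) / (?\<rho> i t + ?\<rho> j t)" for i j
  proof -
    \<comment> \<open>In the difference of two squared ranges \<open>(norm (x1 t))\<^sup>2\<close>
      cancels. Factoring it as difference times sum and dividing by the positive sum gives a
      relation linear in the state.\<close>
    have "2 * ((b i - b j) \<bullet> (x1 t v* R t)) + (?\<rho> i t - ?\<rho> j t) * (?\<rho> i t + ?\<rho> j t) =
      (norm (b i))\<^sup>2 - (norm (b j))\<^sup>2"
      using nl_range_power2[where R = R and t = t, OF assms(1), of b x1 i]
        nl_range_power2[where R = R and t = t, OF assms(1), of b x1 j]
      by (simp add: inner_diff_left algebra_simps power2_eq_square)
    moreover have "?\<rho> i t + ?\<rho> j t > 0"
      using pos[of i] pos[of j] by simp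
    ultimately show ?thesis
      by (simp add: field_simps)
  qed
  show ?thesis
    unfolding vec_eq_iff
  proof
    fix m
    show "(ltv_C b R ?\<rho> t *v augmented_state ?\<rho> x1 x2 t) $ m = nl_output b ?\<rho> t $ m"
    proof (cases m)
      case (Inl k)
      then show ?thesis
        by (simp add: matrix_vector_mul_component ltv_C_def augmented_state_def inner_blocks
            nl_output_def inner_diff_left inner_axis')
    next
      case (Inr p)
      then show ?thesis
        using pair[of "pfst p" "psnd p"]
        by (simp add: matrix_vector_mul_component ltv_C_def augmented_state_def inner_blocks
            nl_output_def inner_diff_left inner_axis' dot_lmul_matrix
            del: vector_transpose_matrix)
    qed
  qed
qed

text \<open>Chain rule for the norm; a positive range keeps its argument away from 0, where the norm
  is not differentiable. With \<open>x1 t \<bullet> v\<close> taken as a separate state the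
  numerator is linear, and its two terms in \<open>c\<close> go one to \<open>ltv_A\<close> and one
  to \<open>ltv_B\<close>.\<close>

lemma nl_range_has_vector_derivative:
  assumes x1: "(x1 has_vector_derivative - v - c) (at t within S)"
    and R: "(R has_vector_derivative R t ** skew \<omega>) (at t within S)"
    and rot: "rotation_matrix (R t)" and pos: "nl_range b R x1 i t > 0"
  shows "(nl_range b R x1 i has_vector_derivative
    (b i \<bullet> cross3 \<omega> (x1 t v* R t) - c \<bullet> x1 t + b i \<bullet> (v v* R t) - x1 t \<bullet> v
      + b i \<bullet> (c v* R t)) / nl_range b R x1 i t) (at t within S)"
proof -
  define z where "z = (\<lambda>t. x1 t v* R t)"
  define z' where "z' = x1 t v* (R t ** skew \<omega>) + (- v - c) v* R t"
  \<comment> \<open>Skew symmetry: the adjoint of \<open>cross3 v\<close> is its negative.\<close>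
  have skew_adj: "a \<bullet> (y v* skew v) = - (a \<bullet> cross3 v y)" for a y v
    by (simp add: inner_commute[of a "y v* _"] dot_lmul_matrix skew_mult)
       (simp add: cross3_simps)
  have z: "(z has_vector_derivative z') (at t within S)"
    unfolding z_def z'_def
    by (rule bounded_bilinear.has_vector_derivative
          [OF bounded_bilinear_vector_matrix_mult x1 R])
  have "((\<lambda>s. b i - z s) has_derivative (\<lambda>h. - (h *\<^sub>R z'))) (at t within S)"
    using z by (auto intro!: derivative_eq_intros simp: has_vector_derivative_def)
  moreover have "b i - z t \<noteq> 0"
    using pos by (auto simp: nl_range_def z_def)
  ultimately have "((\<lambda>s. norm (b i - z s)) has_derivative
      (\<lambda>h. (- (h *\<^sub>R z')) \<bullet> sgn (b i - z t))) (at t within S)"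
    by (intro has_derivative_compose[OF _ has_derivative_norm])
  then have "((\<lambda>s. norm (b i - z s)) has_vector_derivative
      (- z' \<bullet> (b i - z t)) / norm (b i - z t)) (at t within S)"
    by (simp add: has_vector_derivative_def sgn_div_norm divide_inverse algebra_simps)
  \<comment> \<open>The term \<open>z t \<bullet> cross3 \<omega> (z t)\<close> vanishes, and the
    rotation drops out of the products of \<open>z t\<close> with the rotated \<open>v\<close> and
    \<open>c\<close>.\<close>
  moreover have "- z' \<bullet> (b i - z t) = b i \<bullet> cross3 \<omega> (x1 t v* R t) - c \<bullet> x1 t
      + b i \<bullet> (v v* R t) - x1 t \<bullet> v + b i \<bullet> (c v* R t)"
  proof -
    have "z' = z t v* skew \<omega> - v v* R t - c v* R t"
      \<comment> \<open>The instance at 0 lets the minus sign be pulled out of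
        \<open>(- v) v* R t\<close>.\<close>
      using vector_matrix_mult_diff_distrib[of 0 v "R t"]
      by (simp add: z'_def z_def vector_matrix_mul_assoc vector_matrix_mult_diff_distrib)
    then have "(b i - z t) \<bullet> (- z') = b i \<bullet> cross3 \<omega> (z t) + b i \<bullet> (v v* R t)
        + b i \<bullet> (c v* R t) - z t \<bullet> (v v* R t) - z t \<bullet> (c v* R t)"
      by (simp add: inner_diff_left inner_diff_right inner_add_right skew_adj dot_cross_self)
    then show ?thesis
      using rotation_matrix_inner[OF rot]
      by (simp add: z_def inner_commute[of z'] inner_commute[of c])
  qed
  ultimately show ?thesis
    by (simp only: nl_range_def[abs_def] z_def transpose_matrix_vector)
qed

text \<open>The two extra states close the system: the range derivatives involve
  \<open>x1 \<bullet> x2\<close>, whose derivative brings in only \<open>u \<bullet> x2\<close> and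
  the constant \<open>(norm x2)\<^sup>2\<close>. With the ranges as known coefficients everything is
  linear.\<close>

lemma ltv_solution_augmented_state:
  assumes att: "attitude_signal t0 R w" and nl: "nl_trajectory b R u t0 x1 x2"
  shows "ltv_solution b R w u (nl_range b R x1) t0 (augmented_state (nl_range b R x1) x1 x2)"
  unfolding ltv_solution_def
proof (intro allI impI)
  fix t assume t: "t0 \<le> t"
  let ?\<rho> = "nl_range b R x1"
  have x1: "(x1 has_vector_derivative - x2 t - u t) (at t within {t0..})"
    and x2: "(x2 has_vector_derivative 0) (at t within {t0..})"
    and pos: "?\<rho> i t > 0" for i
    using nl t by (auto simp: nl_trajectory_def intro: less_le_trans)
  have R: "(R has_vector_derivative R t ** skew (w t)) (at t within {t0..})"
    and rot: "rotation_matrix (R t)"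
    using att t by (auto simp: attitude_signal_def)
  show "(augmented_state ?\<rho> x1 x2 has_vector_derivative
      ltv_A b R w u ?\<rho> t *v augmented_state ?\<rho> x1 x2 t + ltv_B b R ?\<rho> t *v u t)
      (at t within {t0..})"
    unfolding augmented_state_def[abs_def] ltv_A_mult_blocks ltv_B_mult blocks_add
  proof (rule has_vector_derivative_blocks)
    \<comment> \<open>The trailing \<open>+ 0\<close> here and in the next goal is the zero block of
      the input term.\<close>
    show "((\<lambda>t. x1 t \<bullet> x2 t) has_vector_derivative
        - (u t \<bullet> x2 t) - (norm (x2 t))\<^sup>2 + 0) (at t within {t0..})"
      by (rule has_vector_derivative_eq_rhs
            [OF bounded_bilinear.has_vector_derivative[OF bounded_bilinear_inner x1 x2]])
         (simp add: power2_norm_eq_inner inner_diff_left)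
    show "((\<lambda>t. (norm (x2 t))\<^sup>2) has_vector_derivative 0 + 0) (at t within {t0..})"
      unfolding power2_norm_eq_inner
      by (rule has_vector_derivative_eq_rhs
            [OF bounded_bilinear.has_vector_derivative[OF bounded_bilinear_inner x2 x2]]) simp
    fix i
    show "((\<lambda>t. (\<chi> i. ?\<rho> i t) $ i) has_vector_derivative
        ((\<chi> i. (b i \<bullet> cross3 (w t) (x1 t v* R t) - u t \<bullet> x1 t + b i \<bullet> (x2 t v* R t)
           - x1 t \<bullet> x2 t) / ?\<rho> i t) + (\<chi> i. b i \<bullet> (u t v* R t) / ?\<rho> i t)) $ i) (at t within {t0..})"
      using nl_range_has_vector_derivative[where R = R and t = t, OF x1 R rot pos[of i]]
      by (simp add: add_divide_distrib[symmetric])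
  qed (use x1 x2 in simp_all)
qed

text \<open>The measured and the linear output are only shown to agree from \<open>t0\<close> on.
  This suffices because \<open>gas_error\<close> uses the output only through
  \<open>observer_solution\<close>, which looks at times \<open>t \<ge> t0\<close>.\<close>

lemma gas_error_cong:
  assumes "\<And>t. t \<ge> t0 \<Longrightarrow> y t = y' t"
  shows "gas_error F y t0 x = gas_error F y' t0 x"
proof -
  have "observer_solution F y t0 = observer_solution F y' t0"
    using assms by (auto simp: observer_solution_def fun_eq_iff)
  then show ?thesis by (simp add: gas_error_def)
qed

section \<open>Recovering the initial state\<close>

lemma nl_output_eq_imp_nl_range_eq:
  assumes "nl_output b \<rho> t = nl_output b \<rho>' t"
  shows "\<rho> i t = \<rho>' i t"
proof -
  have eq: "nl_output b \<rho> t $ Inl k = nl_output b \<rho>' t $ Inl k" for k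
    using assms by simp
  \<comment> \<open>The \<open>first_receiver\<close> component is that range itself; subtracting
    any other component from it isolates \<open>\<rho> i t\<close>.\<close>
  from eq[of first_receiver] eq[of i] show ?thesis
    by (auto simp: nl_output_def split: if_splits)
qed

lemma nl_range_inj:
  fixes b :: "'n::finite \<Rightarrow> real^3"
  assumes rot: "rotation_matrix (R t)"
    and nc: "\<exists>i j k l. \<not> coplanar {b i, b j, b k, b l}"
    and eq: "\<And>i. nl_range b R x1 i t = nl_range b R x1' i t"
  shows "x1 t = x1' t"
proof -
  define a where "a = x1 t v* R t - x1' t v* R t"
  obtain i j k l where nc: "\<not> coplanar {b i, b j, b k, b l}"
    using nc by (elim exE)
  \<comment> \<open>Comparing the two expansions of the squared range removes
    \<open>norm (b m)\<close>. The right-hand side is free of \<open>m\<close>, so all receivers lie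
    in one plane if \<open>a\<close> is nonzero.\<close>
  have "a \<bullet> b m = ((norm (x1 t))\<^sup>2 - (norm (x1' t))\<^sup>2) / 2" for m
  proof -
    have "(norm (b m))\<^sup>2 - 2 * (b m \<bullet> (x1 t v* R t)) + (norm (x1 t))\<^sup>2 =
      (norm (b m))\<^sup>2 - 2 * (b m \<bullet> (x1' t v* R t)) + (norm (x1' t))\<^sup>2"
      unfolding nl_range_power2[where R = R and t = t, OF rot, symmetric] eq ..
    moreover have "p - q = (r - s) / 2" if "y - 2 * p + r = y - 2 * q + s" for p q r s y :: real
      using that by simp
    ultimately show ?thesis
      unfolding a_def inner_commute[of _ "b m"] inner_diff_right by blast
  qed
  then have "{b i, b j, b k, b l} \<subseteq> {x. a \<bullet> x = ((norm (x1 t))\<^sup>2 - (norm (x1' t))\<^sup>2) / 2}"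
    by blast
  with nc have "a = 0"
    using coplanar_subset_hyperplane[of a "{b i, b j, b k, b l}"] by (cases "a = 0") simp_all
  then have "(x1 t - x1' t) v* R t = 0"
    unfolding a_def vector_matrix_mult_diff_distrib .
  then show ?thesis
    using rotation_matrix_inner[OF rot, of "x1 t - x1' t" "x1 t - x1' t"] by simp
qed

lemma nl_observable:
  fixes b :: "'n::{finite, linorder} \<Rightarrow> real^3"
  assumes "t0 < tf"
    and nc: "\<exists>i j k l. \<not> coplanar {b i, b j, b k, b l}"
    and att: "attitude_signal t0 R w"
  shows "nl_observable b R t0 tf"
  unfolding nl_observable_def
proof (intro allI impI, elim conjE)
  fix u u' x1 x2 x1' x2'
  assume nl: "nl_trajectory b R u t0 x1 x2" "nl_trajectory b R u' t0 x1' x2'"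
    and u: "\<forall>t\<in>{t0..tf}. u t = u' t"
    and y: "\<forall>t\<in>{t0..tf}. nl_output b (nl_range b R x1) t = nl_output b (nl_range b R x1') t"
  have eq: "x1 t = x1' t" if "t \<in> {t0..tf}" for t
  proof (rule nl_range_inj[OF _ nc])
    show "rotation_matrix (R t)"
      using att that by (simp add: attitude_signal_def)
    show "nl_range b R x1 i t = nl_range b R x1' i t" for i
      using y that by (intro nl_output_eq_imp_nl_range_eq) (rule bspec)
  qed
  have t0: "t0 \<in> {t0..tf}" using \<open>t0 < tf\<close> by simp
  \<comment> \<open>The derivatives are restricted to \<open>{t0..tf}\<close>, where the positions
    and inputs agree; as \<open>t0 < tf\<close>, the one-sided derivative at \<open>t0\<close> is
    still unique.\<close>
  have "(x1 has_vector_derivative - x2 t0 - u t0) (at t0 within {t0..tf})"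
    "(x1' has_vector_derivative - x2' t0 - u' t0) (at t0 within {t0..tf})"
    using nl by (auto simp: nl_trajectory_def intro: has_vector_derivative_within_subset)
  moreover from this(2) have "(x1 has_vector_derivative - x2' t0 - u' t0) (at t0 within {t0..tf})"
    by (rule has_vector_derivative_transform[OF t0, rotated]) (simp add: eq)
  ultimately have "- x2 t0 - u t0 = - x2' t0 - u' t0"
    using vector_derivative_unique_within_closed_interval[of t0 tf t0 x1] \<open>t0 < tf\<close> t0
    unfolding cbox_interval by metis
  moreover have "u t0 = u' t0"
    using u t0 by (rule bspec)
  ultimately show "x1 t0 = x1' t0 \<and> x2 t0 = x2' t0"
    using eq[OF t0] by simp
qed

theorem theorem2:
  fixes t0 tf :: real
    and b :: "'n::{finite, linorder} \<Rightarrow> real^3"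
    and R :: "real \<Rightarrow> real^3^3"
    and w :: "real \<Rightarrow> real^3"
  assumes "t0 < tf"
    and "\<exists>i j k l. \<not> coplanar {b i, b j, b k, b l}"
    and "attitude_signal t0 R w"
  shows "nl_observable b R t0 tf \<and>
    (\<forall>u x1 x2 F. input_signal t0 u \<and> nl_trajectory b R u t0 x1 x2 \<and>
        ltv_observer b R w u (nl_range b R x1) t0 F
      \<longrightarrow> nl_observer b R t0 x1 x2 F)"
proof (rule conjI)
  show "nl_observable b R t0 tf"
    by (rule nl_observable[OF assms])
next
  show "\<forall>u x1 x2 F. input_signal t0 u \<and> nl_trajectory b R u t0 x1 x2 \<and>
        ltv_observer b R w u (nl_range b R x1) t0 F
      \<longrightarrow> nl_observer b R t0 x1 x2 F"
  proof (intro allI impI, elim conjE)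
    fix u x1 x2 F
    assume nl: "nl_trajectory b R u t0 x1 x2"
      and obs: "ltv_observer b R w u (nl_range b R x1) t0 F"
    let ?\<rho> = "nl_range b R x1" and ?x = "augmented_state (nl_range b R x1) x1 x2"
    have "ltv_C b R ?\<rho> t *v ?x t = nl_output b ?\<rho> t" if "t \<ge> t0" for t
    proof (rule ltv_C_mult_augmented_state)
      show "rotation_matrix (R t)"
        using assms(3) that by (simp add: attitude_signal_def)
      show "?\<rho> i t > 0" for i
        using nl that by (auto simp: nl_trajectory_def intro: less_le_trans)
    qed
    then have "gas_error F (\<lambda>t. ltv_C b R ?\<rho> t *v ?x t) t0 ?x = gas_error F (nl_output b ?\<rho>) t0 ?x"
      by (rule gas_error_cong)
    \<comment> \<open>\<open>ltv_observer\<close> speaks of every solution of the linear system,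
      hence of the augmented state.\<close>
    moreover have "gas_error F (\<lambda>t. ltv_C b R ?\<rho> t *v ?x t) t0 ?x"
      using obs ltv_solution_augmented_state[OF assms(3) nl] unfolding ltv_observer_def by blast
    ultimately show "nl_observer b R t0 x1 x2 F"
      unfolding nl_observer_def by simp
  qed
qed

end
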